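(* Let $i\ge 1$ and $L\ge 1$ be integers, let $a_1,\dots,a_i$ be non-negative integers with $a_i\ge a_j$ for all $j\in[i]$, and let $K=1+(i-1)L+\sum_{j=1}^{i}a_j$. Let $R^*$ be the optimal transmission rate of the $\overline{(a_i,a_{i-1},\dots,a_1)}_L$-ICP (which has $K$ users). Then $$R^*\le R_u:=\min\{2(K-(i-1)L)+i-2-a_i,\;K\}.$$
   Context: Notation: $[n]=\{1,\dots,n\}$; $\langle m\rangle_n$ is the unique element of $[n]$ congruent to $m$ modulo $n$. Index coding problem (ICP): a server holds a finite collection of files, each of size 1 unit ($F$ bits, $F$ sufficiently large), mutually unrelated (arbitrary $F$-bit strings). There are $K$ users; user $k$ wants the set of files $\mathcal W_k$ and knows the set of files $\mathcal K_k$ (side-information), with $\mathcal K_k\cap\mathcal W_k=\emptyset$. The server broadcasts one message (a function of all the files) such that every user $k$ can recover all files in $\mathcal W_k$ from the message and the files in $\mathcal K_k$. The optimal transmission rate $R^*$ is the minimum (infimum) message size, in units of the file size, over all coding strategies (and $F$ large). The $\overline{(a_i,a_{i-1},\dots,a_1)}_L$-ICP: for non-negative integers $a_1,\dots,a_i$ and a positive integer $L$, put $K=1+(i-1)L+\sum_{j=1}^i a_j$. There are $K$ users and $iK$ files $x_{k,t}$, $k\in[K]$, $t\in[i]$. User $k\in[K]$ wants $\mathcal W_k=\{x_{k,1},\dots,x_{k,i}\}$ and knows $$\mathcal K_k=\Big\{x_{b,t}: t\in[i],\,v\in[i-1],\,r\in[L],\ b=\Big\langle k+\sum_{j=1}^{v}a_{\langle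 i+t-j\rangle_i}+(v-1)L+r\Big\rangle_K\Big\}.$$ (That is, for each fixed $t$, going cyclically from $x_{k,t}$ one sees $a_{\langle t-1\rangle_i}$ unknown files, $L$ known files, $a_{\langle t-2\rangle_i}$ unknown files, $L$ known files, and so on, ending with $a_t$ unknown files.) *)

theory Defs
  imports Complex_Main "HOL-Library.FuncSet" "HOL-Number_Theory.Cong"
begin

section \<open>Index coding problems\<close>

record ('u, 'x) icp =
  users :: "'u set"
  files :: "'x set"
  wants :: "'u \<Rightarrow> 'x set"
  knows :: "'u \<Rightarrow> 'x set"

definition valid_icp :: "('u, 'x) icp \<Rightarrow> bool" where
  "valid_icp P \<longleftrightarrow>
     finite (users P) \<and> finite (files P) \<and>
     (\<forall>k\<in>users P. wants P k \<subseteq> files P \<and> knows P k \<subseteq> files P \<and> knows P k \<inter> wants P k = {})"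

definition bitstrings :: "nat \<Rightarrow> bool list set" where
  "bitstrings n = {bs. length bs = n}"

text \<open>All joint contents of the files; the files are unrelated, so every combination of
  strings occurs.\<close>

definition contents :: "('u, 'x) icp \<Rightarrow> nat \<Rightarrow> ('x \<Rightarrow> bool list) set" where
  "contents P F = (files P \<rightarrow>\<^sub>E bitstrings F)"

text \<open>User \<open>k\<close> decodes from the broadcast message and the contents of the files it knows;
  \<^const>\<open>restrict\<close> hides the contents of all other files.\<close>

definition is_index_code ::
  "('u, 'x) icp \<Rightarrow> nat \<Rightarrow> nat \<Rightarrow> (('x \<Rightarrow> bool list) \<Rightarrow> bool list) \<Rightarrow>
   ('u \<Rightarrow> bool list \<Rightarrow> ('x \<Rightarrow> bool list) \<Rightarrow> 'x \<Rightarrow> bool list) \<Rightarrow> bool" where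
  "is_index_code P F l enc dec \<longleftrightarrow>
     (\<forall>X\<in>contents P F. enc X \<in> bitstrings l \<and>
        (\<forall>k\<in>users P. \<forall>f\<in>wants P k. dec k (enc X) (restrict X (knows P k)) f = X f))"

definition code_rates :: "('u, 'x) icp \<Rightarrow> real set" where
  "code_rates P = {real l / real F | F l. F \<ge> 1 \<and> (\<exists>enc dec. is_index_code P F l enc dec)}"

text \<open>Using a code blockwise \<open>n\<close> times turns file size \<open>F\<close> and message length \<open>l\<close> into
  \<open>n * F\<close> and \<open>n * l\<close>, so every rate is also attained at arbitrarily large file sizes: the
  infimum over all \<open>F \<ge> 1\<close> is the infimum over all sufficiently large \<open>F\<close>.\<close>

definition optimal_rate :: "('u, 'x) icp \<Rightarrow> real" where
  "optimal_rate P = Inf (code_rates P)"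

lemma code_rates_bdd_below: "bdd_below (code_rates P)"
  unfolding code_rates_def by (rule bdd_belowI [of _ 0]) auto

text \<open>Sending everything is always possible, so the infimum is over a nonempty set.\<close>

lemma code_rates_nonempty:
  assumes "valid_icp P"
  shows "code_rates P \<noteq> {}"
proof -
  from assms have "finite (files P)" by (simp add: valid_icp_def)
  then obtain fs where fs: "set fs = files P" by (auto dest: finite_list)
  define enc where "enc = (\<lambda>X :: 'b \<Rightarrow> bool list. map (\<lambda>f. hd (X f)) fs)"
  define dec where
    "dec = (\<lambda>(k :: 'a) (m :: bool list) (S :: 'b \<Rightarrow> bool list) f. [the (map_of (zip fs m) f)])"
  have "dec k (enc X) S f = X f" if "X \<in> contents P 1" "f \<in> files P" for k X S f
  proof -
    have "length (X f) = 1"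
      using that by (auto simp: contents_def bitstrings_def PiE_iff)
    then have "[hd (X f)] = X f" by (cases "X f") auto
    moreover have "map_of (zip fs (map (\<lambda>f. hd (X f)) fs)) f = Some (hd (X f))"
      using that fs by (simp add: map_of_zip_map)
    ultimately show ?thesis by (simp add: dec_def enc_def)
  qed
  then have "is_index_code P 1 (length fs) enc dec"
    using assms by (simp add: is_index_code_def valid_icp_def bitstrings_def enc_def subset_iff)
  then have "real (length fs) / real 1 \<in> code_rates P"
    unfolding code_rates_def by (intro CollectI exI conjI) (rule refl, rule order_refl)
  then show ?thesis by auto
qed


section \<open>The cyclic problem with overlapping side-information\<close>

definition wrap :: "nat \<Rightarrow> nat \<Rightarrow> nat" where
  "wrap m n = (if n dvd m then n else m mod n)"

lemma wrap_unique:
  assumes "n \<ge> 1"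
  shows "r \<in> {1..n} \<and> [r = m] (mod n) \<longleftrightarrow> r = wrap m n"
proof
  have *: "wrap m n \<in> {1..n} \<and> [wrap m n = m] (mod n)"
  proof (cases "n dvd m")
    case True
    then show ?thesis using assms by (simp add: wrap_def cong_def)
  next
    case False
    then have "m mod n > 0" by (simp add: mod_greater_zero_iff_not_dvd)
    moreover have "m mod n < n" using assms by simp
    ultimately show ?thesis using False by (simp add: wrap_def cong_def)
  qed
  show "r \<in> {1..n} \<and> [r = m] (mod n)" if "r = wrap m n"
    using * that by simp
  assume r: "r \<in> {1..n} \<and> [r = m] (mod n)"
  then have "r mod n = m mod n" by (simp add: cong_def)
  then show "r = wrap m n"
    using r by (cases "r = n") (auto simp: wrap_def mod_eq_0_iff_dvd)
qed

lemma
  assumes "n \<ge> 1"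
  shows wrap_in: "wrap m n \<in> {1..n}" and wrap_cong: "[wrap m n = m] (mod n)"
  using wrap_unique [OF assms, of "wrap m n" m] by simp_all

definition num_users :: "nat \<Rightarrow> nat \<Rightarrow> (nat \<Rightarrow> nat) \<Rightarrow> nat" where
  "num_users i L a = 1 + (i - 1) * L + (\<Sum>j = 1..i. a j)"

text \<open>The pair \<open>(k, t)\<close> stands for the file $x_{k,t}$.\<close>

definition cyclic_icp :: "nat \<Rightarrow> nat \<Rightarrow> (nat \<Rightarrow> nat) \<Rightarrow> (nat, nat \<times> nat) icp" where
  "cyclic_icp i L a =
     \<lparr> users = {1..num_users i L a},
       files = {1..num_users i L a} \<times> {1..i},
       wants = (\<lambda>k. {(k, t) | t. t \<in> {1..i}}),
       knows = (\<lambda>k. {(b, t) | b t v r. t \<in> {1..i} \<and> v \<in> {1..i - 1} \<and> r \<in> {1..L} \<and>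
         b = wrap (k + (\<Sum>j = 1..v. a (wrap (i + t - j) i)) + (v - 1) * L + r)
               (num_users i L a)}) \<rparr>"

lemma valid_cyclic_icp: "valid_icp (cyclic_icp i L a)"
proof -
  let ?K = "num_users i L a"
  have K: "?K \<ge> 1" by (simp add: num_users_def)
  have in_range: "wrap m ?K \<in> {1..?K}" for m
    by (rule wrap_in [OF K])
  have neq: "wrap (k + (\<Sum>j = 1..v. a (wrap (i + t - j) i)) + (v - 1) * L + r) ?K \<noteq> k"
    if k: "k \<in> {1..?K}" and t: "t \<in> {1..i}" and v: "v \<in> {1..i - 1}" and r: "r \<in> {1..L}"
    for k t v r
  proof
    let ?S = "\<Sum>j = 1..v. a (wrap (i + t - j) i)"
    let ?d = "?S + (v - 1) * L + r"
    have i: "i \<ge> 1" using t by simp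
    have "inj_on (\<lambda>j. wrap (i + t - j) i) {1..v}"
    proof (rule inj_onI)
      fix x y assume x: "x \<in> {1..v}" and y: "y \<in> {1..v}"
        and eq: "wrap (i + t - x) i = wrap (i + t - y) i"
      have "[i + t - x = i + t - y] (mod i)"
        using wrap_cong [OF i, of "i + t - x"] wrap_cong [OF i, of "i + t - y"] eq
        by (simp add: cong_def)
      then have "[int (i + t - x) = int (i + t - y)] (mod int i)"
        by (simp add: cong_int_iff)
      then have "int i dvd int (i + t - x) - int (i + t - y)"
        by (simp add: cong_iff_dvd_diff)
      moreover have "int (i + t - x) - int (i + t - y) = int y - int x"
        using x y v t by auto
      ultimately have "int i dvd int y - int x" by simp
      moreover have "\<bar>int y - int x\<bar> < int i" using x y v by auto
      ultimately show "x = y" using zdvd_not_zless [of "\<bar>int y - int x\<bar>" "int i"] by auto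
    qed
    then have "?S = (\<Sum>j \<in> (\<lambda>j. wrap (i + t - j) i) ` {1..v}. a j)"
      by (simp add: sum.reindex)
    also have "\<dots> \<le> (\<Sum>j = 1..i. a j)"
    proof (rule sum_mono2)
      show "(\<lambda>j. wrap (i + t - j) i) ` {1..v} \<subseteq> {1..i}"
        by (rule image_subsetI) (rule wrap_in [OF i])
    qed simp_all
    finally have "?S \<le> (\<Sum>j = 1..i. a j)" .
    moreover have "(v - 1) * L + r \<le> (i - 1) * L"
    proof -
      have "(v - 1) * L + r \<le> (v - 1) * L + L" using r by simp
      also have "\<dots> = v * L" using v by (cases v) auto
      also have "\<dots> \<le> (i - 1) * L" using v by (intro mult_le_mono1) simp
      finally show ?thesis .
    qed
    ultimately have "?d < ?K" by (simp add: num_users_def)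
    moreover have "?d > 0" using r by simp
    moreover assume "wrap (k + ?S + (v - 1) * L + r) ?K = k"
    then have "[k = k + ?S + (v - 1) * L + r] (mod ?K)"
      using wrap_cong [OF K, of "k + ?S + (v - 1) * L + r"] by simp
    then have "[k + 0 = k + ?d] (mod ?K)" by (simp add: add.assoc)
    then have "[0 = ?d] (mod ?K)" by (simp only: cong_add_lcancel_nat)
    then have "?K dvd ?d" by (simp only: cong_0_iff cong_sym_eq [of 0])
    ultimately show False using dvd_imp_le [of ?K ?d] by linarith
  qed
  have "finite (users (cyclic_icp i L a))" "finite (files (cyclic_icp i L a))"
    by (simp_all add: cyclic_icp_def)
  moreover have "wants (cyclic_icp i L a) k \<subseteq> files (cyclic_icp i L a)"
    if "k \<in> users (cyclic_icp i L a)" for k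
    using that by (auto simp: cyclic_icp_def)
  moreover have "knows (cyclic_icp i L a) k \<subseteq> files (cyclic_icp i L a)" for k
  proof
    fix x assume "x \<in> knows (cyclic_icp i L a) k"
    then obtain b t m where "x = (b, t)" "t \<in> {1..i}" "b = wrap m ?K"
      by (auto simp: cyclic_icp_def)
    then show "x \<in> files (cyclic_icp i L a)"
      using in_range [of m] by (simp add: cyclic_icp_def)
  qed
  moreover have "knows (cyclic_icp i L a) k \<inter> wants (cyclic_icp i L a) k = {}"
    if "k \<in> users (cyclic_icp i L a)" for k
  proof -
    have k: "k \<in> {1..?K}" using that by (simp add: cyclic_icp_def)
    show ?thesis
      unfolding cyclic_icp_def icp.simps
    proof (intro equals0I, elim IntE CollectE exE conjE)
      fix x b t v r t'
      assume "x = (b, t)" "x = (k, t')" "t \<in> {1..i}" "v \<in> {1..i - 1}" "r \<in> {1..L}"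
        "b = wrap (k + (\<Sum>j = 1..v. a (wrap (i + t - j) i)) + (v - 1) * L + r) ?K"
      then show False using neq [OF k, of t v r] by simp
    qed
  qed
  ultimately show ?thesis unfolding valid_icp_def by blast
qed

end

theory Submission
  imports Defs "HOL-Computational_Algebra.Polynomial"
begin

text \<open>
  Give the file \<open>x\<^bsub>b,t\<^esub>\<close> the label \<open>b + c\<^sub>t\<close> modulo \<open>K\<close>, where \<open>c\<^sub>t = \<Sum>j=t..<i. (a\<^sub>j + L)\<close>, and
  add up the files with equal labels. Then user \<open>k\<close> knows every file that shares a label with
  one it wants, so it only needs the \<open>K\<close> label sums; moreover it already knows all summands for
  the labels \<open>k + c\<^sub>w - q\<close> with \<open>1 \<le> w < i\<close> and \<open>a\<^sub>w < q < L\<close>. It therefore misses at most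
  \<open>K - (\<Sum>w=1..<i. max 0 (L - 1 - a\<^sub>w))\<close> label sums, and it recovers these from that many Vandermonde
  syndromes. Computing the syndromes over the integers costs only a constant number of extra
  bits per syndrome, which vanishes against the file size.
\<close>

section \<open>Integer linear index codes\<close>

lemma card_bitstrings: "card (bitstrings n) = 2 ^ n"
  and finite_bitstrings: "finite (bitstrings n)"
  using card_lists_length_eq [of "UNIV :: bool set" n]
    finite_lists_length_eq [of "UNIV :: bool set" n]
  by (simp_all add: bitstrings_def)

text \<open>A decoder may return any contents consistent with the message and the side-information.
  By \<open>det\<close> all consistent contents agree on the wanted files, so the choice does not
  matter.\<close>

lemma is_index_code_exists:
  assumes "\<And>X. X \<in> contents P F \<Longrightarrow> enc X \<in> bitstrings l"
    and det: "\<And>X Y k f. \<lbrakk>X \<in> contents P F; Y \<in> contents P F; enc X = enc Y; k \<in> users P;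
      \<forall>g\<in>knows P k. X g = Y g; f \<in> wants P k\<rbrakk> \<Longrightarrow> X f = Y f"
  shows "\<exists>dec. is_index_code P F l enc dec"
proof -
  define sol where "sol = (\<lambda>k m S. SOME X. X \<in> contents P F \<and> enc X = m \<and> restrict X (knows P k) = S)"
  have "sol k (enc X) (restrict X (knows P k)) f = X f"
    if X: "X \<in> contents P F" and k: "k \<in> users P" and f: "f \<in> wants P k" for X k f
  proof -
    let ?Y = "sol k (enc X) (restrict X (knows P k))"
    have Y: "?Y \<in> contents P F \<and> enc ?Y = enc X \<and> restrict ?Y (knows P k) = restrict X (knows P k)"
      unfolding sol_def by (rule someI [of _ X]) (use X in simp)
    then have "\<forall>g\<in>knows P k. ?Y g = X g"
      by (metis restrict_apply')
    with Y show ?thesis using det X k f by blast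
  qed
  then have "is_index_code P F l enc sol"
    using assms(1) by (simp add: is_index_code_def)
  then show ?thesis by blast
qed

text \<open>The message consists of \<open>R\<close> integer combinations of the files, read as
  numbers. The difference of two contents that a user cannot tell apart lies in the kernel of
  \<open>G\<close> and vanishes on the known files, so decodability becomes the kernel condition
  \<open>det\<close>. The \<open>c\<close> extra bits per combination absorb the growth caused by
  the coefficients.\<close>

lemma integer_linear_code:
  fixes G :: "nat \<Rightarrow> 'x \<Rightarrow> nat" and P :: "('u, 'x) icp"
  assumes valid: "valid_icp P"
    and det: "\<And>k x f. \<lbrakk>k \<in> users P; \<forall>j<R. (\<Sum>g\<in>files P. int (G j g) * x g) = 0;
      \<forall>g\<in>knows P k. x g = 0; f \<in> wants P k\<rbrakk> \<Longrightarrow> x f = 0"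
    and c: "(\<Sum>j<R. \<Sum>g\<in>files P. G j g) < 2 ^ c"
  shows "\<exists>enc dec. is_index_code P F (R * (F + c)) enc dec"
proof -
  have sub: "wants P k \<subseteq> files P" if "k \<in> users P" for k
    using valid that by (simp add: valid_icp_def)
  \<comment> \<open>Any numbering of the \<open>F\<close>-bit strings will do: only its injectivity
    and its range are used.\<close>
  obtain val :: "bool list \<Rightarrow> nat" where val: "val ` bitstrings F \<subseteq> {..<2 ^ F}"
    and val_inj: "inj_on val (bitstrings F)"
    using card_le_inj [of "bitstrings F" "{..<2 ^ F :: nat}"]
    by (auto simp: card_bitstrings finite_bitstrings)
  \<comment> \<open>There are exactly as many tuples of \<open>R\<close> numbers below
    \<open>2 ^ (F + c)\<close> as bit strings of length \<open>R * (F + c)\<close>, so an injection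
    \<open>bits\<close> packs the tuple into one message.\<close>
  let ?D = "{..<R} \<rightarrow>\<^sub>E {..<2 ^ (F + c) :: nat}"
  have "card ?D = 2 ^ (R * (F + c))"
    by (simp add: card_PiE power_mult [symmetric] mult.commute)
  then obtain bits :: "(nat \<Rightarrow> nat) \<Rightarrow> bool list" where bits: "bits ` ?D \<subseteq> bitstrings (R * (F + c))"
    and bits_inj: "inj_on bits ?D"
    using card_le_inj [of ?D "bitstrings (R * (F + c))"]
    by (auto simp: card_bitstrings finite_bitstrings finite_PiE)
  define S where "S = (\<lambda>X. \<lambda>j\<in>{..<R}. \<Sum>g\<in>files P. G j g * val (X g))"
  have val_less: "val (X g) < 2 ^ F" if "X \<in> contents P F" "g \<in> files P" for X g
    using that val by (auto simp: contents_def PiE_iff)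
  have S: "S X \<in> ?D" if X: "X \<in> contents P F" for X
  proof -
    have "(\<Sum>g\<in>files P. G j g * val (X g)) < 2 ^ (F + c)" if j: "j < R" for j
    proof -
      have "(\<Sum>g\<in>files P. G j g * val (X g)) \<le> (\<Sum>g\<in>files P. G j g * 2 ^ F)"
        by (intro sum_mono mult_le_mono2 less_imp_le val_less X)
      also have "\<dots> = (\<Sum>g\<in>files P. G j g) * 2 ^ F" by (simp add: sum_distrib_right)
      also have "\<dots> \<le> (\<Sum>j<R. \<Sum>g\<in>files P. G j g) * 2 ^ F"
        using j by (intro mult_le_mono1 member_le_sum) simp_all
      also have "\<dots> < 2 ^ c * 2 ^ F" using c by simp
      finally show ?thesis by (simp add: power_add mult.commute)
    qed
    then show ?thesis by (auto simp: S_def)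
  qed
  have "\<exists>dec. is_index_code P F (R * (F + c)) (bits \<circ> S) dec"
  proof (rule is_index_code_exists)
    show "(bits \<circ> S) X \<in> bitstrings (R * (F + c))" if "X \<in> contents P F" for X
      using bits S [OF that] by auto
  next
    fix X Y k f
    assume X: "X \<in> contents P F" and Y: "Y \<in> contents P F"
      and "(bits \<circ> S) X = (bits \<circ> S) Y" and k: "k \<in> users P"
      and known: "\<forall>g\<in>knows P k. X g = Y g" and f: "f \<in> wants P k"
    then have eq: "S X = S Y" using bits_inj S by (auto dest: inj_onD)
    define x where "x = (\<lambda>g. int (val (X g)) - int (val (Y g)))"
    have "(\<Sum>g\<in>files P. int (G j g) * x g) = 0" if "j < R" for j
    proof -
      have "(\<Sum>g\<in>files P. G j g * val (X g)) = (\<Sum>g\<in>files P. G j g * val (Y g))"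
        using fun_cong [OF eq, of j] that by (simp add: S_def)
      then have "int (\<Sum>g\<in>files P. G j g * val (X g)) = int (\<Sum>g\<in>files P. G j g * val (Y g))"
        by simp
      then show ?thesis by (simp add: x_def right_diff_distrib sum_subtractf)
    qed
    moreover have "\<forall>g\<in>knows P k. x g = 0" using known by (simp add: x_def)
    ultimately have "x f = 0" using det [OF k] f by blast
    moreover have "X f \<in> bitstrings F" "Y f \<in> bitstrings F"
      using X Y f sub [OF k] by (auto simp: contents_def PiE_iff)
    ultimately show "X f = Y f" using inj_onD [OF val_inj] by (simp add: x_def)
  qed
  then show ?thesis by blast
qed

text \<open>The overhead \<open>c\<close> depends on \<open>G\<close> but not on \<open>F\<close>,
  so the rates \<open>R * (F + c) / F\<close> tend to \<open>R\<close>, and the infimum is at most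
  this limit.\<close>

lemma optimal_rate_le_integer_linear:
  fixes G :: "nat \<Rightarrow> 'x \<Rightarrow> nat" and P :: "('u, 'x) icp"
  assumes "valid_icp P"
    and "\<And>k x f. \<lbrakk>k \<in> users P; \<forall>j<R. (\<Sum>g\<in>files P. int (G j g) * x g) = 0;
      \<forall>g\<in>knows P k. x g = 0; f \<in> wants P k\<rbrakk> \<Longrightarrow> x f = 0"
  shows "optimal_rate P \<le> real R"
proof -
  obtain c where c: "(\<Sum>j<R. \<Sum>g\<in>files P. G j g) < 2 ^ c"
    using less_exp by blast
  have le: "optimal_rate P \<le> real R + real (R * c) / real F" if F: "F \<ge> 1" for F
  proof -
    have "real (R * (F + c)) / real F \<in> code_rates P"
      unfolding code_rates_def using integer_linear_code [of P R G c F] assms c F by blast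
    then have "optimal_rate P \<le> real (R * (F + c)) / real F"
      unfolding optimal_rate_def by (rule cInf_lower [OF _ code_rates_bdd_below])
    also have "\<dots> = real R + real (R * c) / real F"
      using F by (simp add: field_simps)
    finally show ?thesis .
  qed
  have "(\<lambda>F. real R + real (R * c) / real F) \<longlonglongrightarrow> real R + 0"
    by (intro tendsto_add tendsto_const lim_const_over_n)
  then show ?thesis
    using le by (intro LIMSEQ_le_const [where X = "\<lambda>F. real R + real (R * c) / real F"]) auto
qed

section \<open>Vandermonde syndromes of label sums\<close>

lemma power_sums_eq_0:
  fixes z :: "'a :: idom \<Rightarrow> 'a"
  assumes "finite W" "card W \<le> R" and syn: "\<And>j. j < R \<Longrightarrow> (\<Sum>m\<in>W. m ^ j * z m) = 0"
    and w: "w \<in> W"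
  shows "z w = 0"
proof -
  \<comment> \<open>Vandermonde argument: \<open>p\<close> has degree \<open>card W - 1 < R\<close>
    and vanishes on \<open>W\<close> except at \<open>w\<close>, so combining the power sums with
    its coefficients isolates \<open>z w\<close>.\<close>
  define p where "p = (\<Prod>v\<in>W - {w}. [:- v, 1:])"
  have "degree p \<le> (\<Sum>v\<in>W - {w}. degree [:- v, 1:])"
    unfolding p_def by (rule degree_prod_sum_le [OF finite_Diff [OF assms(1)], unfolded o_def])
  then have deg: "degree p < R"
    using assms card_gt_0_iff [of W] by (auto simp: card_Diff_singleton)
  have "(\<Sum>m\<in>W. poly p m * z m) = (\<Sum>m\<in>W. \<Sum>j\<le>degree p. coeff p j * (m ^ j * z m))"
    by (simp add: poly_altdef sum_distrib_right mult.assoc)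
  also have "\<dots> = (\<Sum>j\<le>degree p. coeff p j * (\<Sum>m\<in>W. m ^ j * z m))"
    by (subst sum.swap) (simp add: sum_distrib_left)
  also have "\<dots> = 0" using deg syn by simp
  finally have "(\<Sum>m\<in>W. poly p m * z m) = 0" .
  moreover have "poly p m = 0" if "m \<in> W - {w}" for m
    using that assms(1) by (auto simp: p_def poly_prod)
  ultimately have "poly p w * z w = 0"
    using assms(1) w by (simp add: sum.remove [of W w])
  moreover have "poly p w \<noteq> 0" using assms(1) by (auto simp: p_def poly_prod)
  ultimately show ?thesis by simp
qed

text \<open>With coefficients \<open>lab g ^ j\<close>, the syndromes are power sums weighted by the
  label sums of a kernel vector. Known files contribute zero, so at most \<open>R\<close> labels
  remain and all their sums vanish. By \<open>same\<close>, the sum at the label of a wanted file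
  has that file as its only unknown summand.\<close>

lemma optimal_rate_le_labels:
  fixes lab :: "'x \<Rightarrow> nat" and P :: "('u, 'x) icp"
  assumes valid: "valid_icp P"
    and miss: "\<And>k. k \<in> users P \<Longrightarrow> card (lab ` (files P - knows P k)) \<le> R"
    and same: "\<And>k f g. \<lbrakk>k \<in> users P; f \<in> wants P k; g \<in> files P; g \<noteq> f; lab g = lab f\<rbrakk>
      \<Longrightarrow> g \<in> knows P k"
  shows "optimal_rate P \<le> real R"
proof (rule optimal_rate_le_integer_linear [OF valid, where G = "\<lambda>j g. lab g ^ j"])
  fix k f and x :: "'x \<Rightarrow> int"
  assume k: "k \<in> users P" and syn: "\<forall>j<R. (\<Sum>g\<in>files P. int (lab g ^ j) * x g) = 0"
    and known: "\<forall>g\<in>knows P k. x g = 0" and f: "f \<in> wants P k"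
  have fin: "finite (files P)" and f': "f \<in> files P" "f \<notin> knows P k"
    using valid k f by (auto simp: valid_icp_def)
  let ?lab = "\<lambda>g. int (lab g)"
  let ?U = "files P - knows P k"
  define z where "z = (\<lambda>m. \<Sum>g | g \<in> ?U \<and> ?lab g = m. x g)"
  have "z (?lab f) = 0"
  proof (rule power_sums_eq_0 [where z = z and W = "?lab ` ?U" and R = R])
    have "?lab ` ?U = int ` lab ` ?U" by (simp add: image_image)
    then show "card (?lab ` ?U) \<le> R" using miss [OF k] by (simp add: card_image)
  next
    fix j assume j: "j < R"
    have "(\<Sum>m\<in>?lab ` ?U. m ^ j * z m) = (\<Sum>m\<in>?lab ` ?U. \<Sum>g | g \<in> ?U \<and> ?lab g = m. ?lab g ^ j * x g)"
      by (auto simp: z_def sum_distrib_left intro!: sum.cong)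
    also have "\<dots> = (\<Sum>g\<in>?U. ?lab g ^ j * x g)"
      using fin by (intro sum.group) auto
    also have "\<dots> = (\<Sum>g\<in>files P. ?lab g ^ j * x g)"
      using fin known by (intro sum.mono_neutral_left) auto
    also have "\<dots> = 0" using syn j by simp
    finally show "(\<Sum>m\<in>?lab ` ?U. m ^ j * z m) = 0" .
  qed (use fin f' in auto)
  moreover have "{g. g \<in> ?U \<and> ?lab g = ?lab f} = {f}"
    using same [OF k f] f' by auto
  ultimately show "x f = 0" by (simp add: z_def)
qed


section \<open>The cyclic labelling\<close>

lemma wrap_eq_iff_cong:
  assumes "n \<ge> 1"
  shows "wrap x n = wrap y n \<longleftrightarrow> [x = y] (mod n)"
  by (metis assms cong_def wrap_cong wrap_unique)

lemma wrap_self: "x \<in> {1..n} \<Longrightarrow> wrap x n = x"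
  using wrap_unique [of n x x] by simp

lemma wrap_add_self: "x \<in> {1..n} \<Longrightarrow> wrap (x + n) n = x"
  using wrap_unique [of n x "x + n"] by (simp add: cong_def)

text \<open>This is c_t. Adding it aligns the known blocks of different file indices: for user k,
  the blocks of index t end at label k + c_w for w < t and start at label k + c_u for u > t, modulo
  K.\<close>

definition shift :: "nat \<Rightarrow> nat \<Rightarrow> (nat \<Rightarrow> nat) \<Rightarrow> nat \<Rightarrow> nat" where
  "shift i L a t = (\<Sum>j = t..<i. a j + L)"

lemma shift_rec: "t < i \<Longrightarrow> shift i L a t = a t + L + shift i L a (Suc t)"
  by (simp add: shift_def sum.atLeast_Suc_lessThan)

lemma num_users_eq_shift:
  assumes "i \<ge> 1"
  shows "num_users i L a = 1 + shift i L a 1 + a i"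
proof -
  have "{1..i} = insert i {1..<i}" using assms by auto
  then show ?thesis by (simp add: num_users_def shift_def sum.distrib)
qed

text \<open>The sum telescopes: passing to the next smaller index adds one gap and one block, which
  is the increment of \<open>shift\<close>.\<close>

lemma gap_sum_before_wrap:
  assumes "v < t" "t \<le> i"
  shows "(\<Sum>j = 1..v. a (wrap (i + t - j) i)) + v * L + shift i L a t = shift i L a (t - v)"
  using assms(1)
proof (induction v)
  case (Suc v)
  then have "i + t - Suc v = (t - Suc v) + i" "t - Suc v \<in> {1..i}"
    using assms(2) by auto
  then have "wrap (i + t - Suc v) i = t - Suc v" by (simp only: wrap_add_self)
  moreover have "shift i L a (t - Suc v) = a (t - Suc v) + L + shift i L a (t - v)"
    using Suc.prems assms(2) shift_rec [of "t - Suc v" i L a] by (simp add: Suc_diff_Suc)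
  ultimately show ?case using Suc by simp
qed simp

text \<open>After index 1 the gaps continue with index i. A full turn has length K = c_1 + a_i + 1,
  where a_i brings no block with it; hence \<open>v - 1\<close> blocks and the extra 1.\<close>

lemma gap_sum_after_wrap:
  assumes "1 \<le> t" "t \<le> v" "v \<le> i"
  shows "(\<Sum>j = 1..v. a (wrap (i + t - j) i)) + (v - 1) * L + shift i L a t + 1
    = num_users i L a + shift i L a (i + t - v)"
  using assms(2,3)
proof (induction v)
  case (Suc v)
  show ?case
  proof (cases "t = Suc v")
    \<comment> \<open>This is the actual base case: the gap just added is a_i, and
      \<open>shift i L a i\<close> is 0.\<close>
    case True
    have "(\<Sum>j = 1..v. a (wrap (i + t - j) i)) + v * L + shift i L a t = shift i L a 1"
      using gap_sum_before_wrap [of v t i a L] True Suc.prems by simp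
    moreover have "wrap (i + t - Suc v) i = i" "shift i L a i = 0"
      using True Suc.prems wrap_self [of i i] by (simp_all add: shift_def)
    ultimately show ?thesis
      using num_users_eq_shift [of i L a] True Suc.prems by simp
  next
    case False
    let ?u = "i + t - Suc v"
    have u: "1 \<le> ?u" "?u < i" "Suc ?u = i + t - v" using False Suc.prems assms(1) by auto
    obtain w where "v = Suc w" using False Suc.prems assms(1) by (cases v) auto
    moreover have "wrap ?u i = ?u" using u by (intro wrap_self) simp
    moreover have "shift i L a ?u = a ?u + L + shift i L a (i + t - v)"
      using shift_rec [OF u(2), of L a] u(3) by simp
    ultimately show ?thesis using Suc False by simp
  qed
qed (use assms in simp)

text \<open>The label lies in block number \<open>t - w\<close> at position \<open>L - q\<close>.
  The labels k + c_w - q do not depend on t, which lets different file indices share them.\<close>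

lemma known_before_wrap:
  assumes "1 \<le> w" "w < t" "t \<le> i" "q < L" and b: "b \<in> {1..num_users i L a}"
    and cong: "[b + shift i L a t = k + (shift i L a w - q)] (mod num_users i L a)"
  shows "(b, t) \<in> knows (cyclic_icp i L a) k"
proof -
  let ?K = "num_users i L a" and ?S = "\<Sum>j = 1..t - w. a (wrap (i + t - j) i)"
  obtain v where v: "t - w = Suc v" using assms by (cases "t - w") auto
  have "shift i L a w = ?S + (t - w) * L + shift i L a t"
    using gap_sum_before_wrap [of "t - w" t i a L] assms by simp
  then have "shift i L a w - q = ?S + (t - w - 1) * L + (L - q) + shift i L a t"
    using v assms by simp
  with cong have "[b + shift i L a t = (k + ?S + (t - w - 1) * L + (L - q)) + shift i L a t] (mod ?K)"
    by (simp add: add.assoc)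
  then have "[b = k + ?S + (t - w - 1) * L + (L - q)] (mod ?K)"
    by (simp only: cong_add_rcancel_nat)
  then have "b = wrap (k + ?S + (t - w - 1) * L + (L - q)) ?K"
    using b wrap_unique [of ?K b] by simp
  moreover have "t - w \<in> {1..i - 1}" "L - q \<in> {1..L}" "t \<in> {1..i}" using assms by auto
  ultimately show ?thesis unfolding cyclic_icp_def icp.simps by blast
qed

text \<open>Block number \<open>i + t - u\<close> lies past the wrap; the congruence absorbs the
  full turn K, and the \<open>- 1\<close> matches the extra 1 in
  \<open>gap_sum_after_wrap\<close>.\<close>

lemma known_after_wrap:
  assumes "1 \<le> t" "t < u" "u \<le> i" "r \<in> {1..L}" and b: "b \<in> {1..num_users i L a}"
    and cong: "[b + shift i L a t = k + (shift i L a u + r - 1)] (mod num_users i L a)"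
  shows "(b, t) \<in> knows (cyclic_icp i L a) k"
proof -
  let ?K = "num_users i L a" and ?v = "i + t - u"
  let ?S = "\<Sum>j = 1..?v. a (wrap (i + t - j) i)"
  have "?S + (?v - 1) * L + shift i L a t + 1 = ?K + shift i L a u"
    using gap_sum_after_wrap [of t ?v i a L] assms by simp
  then have "k + (shift i L a u + r - 1) + ?K = (k + ?S + (?v - 1) * L + r) + shift i L a t"
    using assms by simp
  moreover have "[b + shift i L a t = k + (shift i L a u + r - 1) + ?K] (mod ?K)"
    using cong by (simp only: cong_def mod_add_self2)
  ultimately have "[b + shift i L a t = (k + ?S + (?v - 1) * L + r) + shift i L a t] (mod ?K)"
    by (simp only:)
  then have "[b = k + ?S + (?v - 1) * L + r] (mod ?K)"
    by (simp only: cong_add_rcancel_nat)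
  then have "b = wrap (k + ?S + (?v - 1) * L + r) ?K"
    using b wrap_unique [of ?K b] by simp
  moreover have "?v \<in> {1..i - 1}" "t \<in> {1..i}" using assms by auto
  ultimately show ?thesis using assms(4) unfolding cyclic_icp_def icp.simps by blast
qed

section \<open>Labels known to a user\<close>

definition label :: "nat \<Rightarrow> nat \<Rightarrow> (nat \<Rightarrow> nat) \<Rightarrow> nat \<times> nat \<Rightarrow> nat" where
  "label i L a = (\<lambda>(b, t). wrap (b + shift i L a t) (num_users i L a))"

text \<open>The label k + c_t of the wanted file is the last one of a known block for every index
  above t (\<open>q = 0\<close>) and the first one of a known block for every index below t
  (\<open>r = 1\<close>).\<close>

lemma same_label_known:
  assumes "L \<ge> 1" and k: "k \<in> users (cyclic_icp i L a)" and f: "f \<in> wants (cyclic_icp i L a) k"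
    and g: "g \<in> files (cyclic_icp i L a)" "g \<noteq> f" "label i L a g = label i L a f"
  shows "g \<in> knows (cyclic_icp i L a) k"
proof -
  let ?K = "num_users i L a"
  have K: "?K \<ge> 1" by (simp add: num_users_def)
  from k have k: "k \<in> {1..?K}" by (simp add: cyclic_icp_def)
  obtain t where t: "f = (k, t)" "t \<in> {1..i}" using f by (auto simp: cyclic_icp_def)
  obtain b s where s: "g = (b, s)" "s \<in> {1..i}" and b: "b \<in> {1..?K}"
    using g by (auto simp: cyclic_icp_def)
  have cong: "[b + shift i L a s = k + shift i L a t] (mod ?K)"
    using g(3) by (simp add: label_def t s wrap_eq_iff_cong [OF K])
  consider "s = t" | "t < s" | "s < t" by linarith
  then show ?thesis
  proof cases
    case 1
    with cong have "[b = k] (mod ?K)" by (simp only: cong_add_rcancel_nat)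
    then have "b = k"
      using b k wrap_unique [OF K, of b k] wrap_unique [OF K, of k k] by simp
    with 1 s t g(2) show ?thesis by simp
  next
    case 2
    then show ?thesis
      using known_before_wrap [of t s i 0 L b a k] assms(1) cong b s t by simp
  next
    case 3
    then show ?thesis
      using known_after_wrap [of s t i 1 L b a k] assms(1) cong b s t by simp
  qed
qed

text \<open>Between c_(w+1) and c_w, indices above w know the L topmost offsets, ending at c_w, and
  the other indices know the L lowest, starting at c_(w+1). As c_w - c_(w+1) = a_w + L, the two
  ranges share exactly the offsets c_w - q with a_w < q < L.\<close>

lemma label_known:
  assumes "w \<in> {1..<i}" "a w < q" "q < L"
    and g: "g \<in> files (cyclic_icp i L a)"
    and lab: "label i L a g = wrap (k + (shift i L a w - q)) (num_users i L a)"
  shows "g \<in> knows (cyclic_icp i L a) k"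
proof -
  let ?K = "num_users i L a"
  have K: "?K \<ge> 1" by (simp add: num_users_def)
  obtain b t where t: "g = (b, t)" "t \<in> {1..i}" and b: "b \<in> {1..?K}"
    using g by (auto simp: cyclic_icp_def)
  have cong: "[b + shift i L a t = k + (shift i L a w - q)] (mod ?K)"
    using lab by (simp add: label_def t wrap_eq_iff_cong [OF K])
  show ?thesis
  proof (cases "w < t")
    case True
    then show ?thesis using known_before_wrap [of w t i q L b a k] assms cong b t by simp
  next
    case False
    \<comment> \<open>The same offset counted from the lower end: a_w < q is what keeps the position
      \<open>1 + L + a w - q\<close> at most L.\<close>
    have "shift i L a w - q = shift i L a (Suc w) + (1 + L + a w - q) - 1"
      using shift_rec [of w i L a] assms by simp
    with cong have "[b + shift i L a t = k + (shift i L a (Suc w) + (1 + L + a w - q) - 1)] (mod ?K)"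
      by (simp only:)
    moreover have "1 + L + a w - q \<in> {1..L}" "1 \<le> t" "t < Suc w" "Suc w \<le> i"
      using False assms t by auto
    ultimately show ?thesis unfolding t(1) using b by (intro known_after_wrap)
  qed
qed

lemma shift_antimono: "s \<le> t \<Longrightarrow> shift i L a t \<le> shift i L a s"
  unfolding shift_def by (intro sum_mono2) auto

text \<open>The fully known labels of \<open>label_known\<close> are counted and removed from the K
  labels. Offsets for different w lie in disjoint intervals, and truncated subtraction gives 0 when
  a_w is too large for an overlap.\<close>

lemma card_missing_labels:
  assumes "i \<ge> 1"
  shows "card (label i L a ` (files (cyclic_icp i L a) - knows (cyclic_icp i L a) k))
    \<le> num_users i L a - (\<Sum>w = 1..<i. L - 1 - a w)"
proof -
  let ?K = "num_users i L a" and ?c = "shift i L a"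
  have K: "?K \<ge> 1" by (simp add: num_users_def)
  define B where "B w = (\<lambda>q. ?c w - q) ` {a w<..<L}" for w
  define M where "M = (\<lambda>d. wrap (k + d) ?K) ` (\<Union>w\<in>{1..<i}. B w)"
  have B: "B w \<subseteq> {?c (Suc w)..<?c w}" if "w \<in> {1..<i}" for w
    using shift_rec [of w i L a] that by (auto simp: B_def)
  have "card (\<Union>w\<in>{1..<i}. B w) = (\<Sum>w = 1..<i. card (B w))"
  proof (rule card_UN_disjoint)
    have "B w \<inter> B u = {}" if "w \<in> {1..<i}" "u \<in> {1..<i}" "w < u" for w u
      using B [OF that(1)] B [OF that(2)] shift_antimono [of "Suc w" u i L a] that(3)
      by fastforce
    then show "\<forall>w\<in>{1..<i}. \<forall>u\<in>{1..<i}. w \<noteq> u \<longrightarrow> B w \<inter> B u = {}"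
      by (metis Int_commute nat_neq_iff)
  qed (auto simp: B_def)
  also have "\<dots> = (\<Sum>w = 1..<i. L - 1 - a w)"
  proof (rule sum.cong)
    fix w assume w: "w \<in> {1..<i}"
    have "inj_on (\<lambda>q. ?c w - q) {a w<..<L}"
      using shift_rec [of w i L a] w by (auto intro!: inj_onI)
    then show "card (B w) = L - 1 - a w" by (simp add: B_def card_image)
  qed simp
  finally have cardB: "card (\<Union>w\<in>{1..<i}. B w) = (\<Sum>w = 1..<i. L - 1 - a w)" .
  have "inj_on (\<lambda>d. wrap (k + d) ?K) (\<Union>w\<in>{1..<i}. B w)"
  proof (rule inj_onI)
    \<comment> \<open>All offsets lie below c_1 < K, so wrapping cannot identify two of
      them.\<close>
    have less: "d < ?K" if "d \<in> (\<Union>w\<in>{1..<i}. B w)" for d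
      using that B shift_antimono [of 1 _ i L a] num_users_eq_shift [OF assms, of L a] by fastforce
    fix d e assume d: "d \<in> (\<Union>w\<in>{1..<i}. B w)" and e: "e \<in> (\<Union>w\<in>{1..<i}. B w)"
      and "wrap (k + d) ?K = wrap (k + e) ?K"
    then have "[d = e] (mod ?K)"
      by (simp add: wrap_eq_iff_cong [OF K] cong_add_lcancel_nat)
    then show "d = e" using less [OF d] less [OF e] by (simp add: cong_def)
  qed
  then have cardM: "card M = (\<Sum>w = 1..<i. L - 1 - a w)"
    using cardB by (simp add: M_def card_image)
  have M: "M \<subseteq> {1..?K}"
    unfolding M_def by (rule image_subsetI) (rule wrap_in [OF K])
  have "label i L a ` (files (cyclic_icp i L a) - knows (cyclic_icp i L a) k) \<subseteq> {1..?K} - M"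
  proof (rule image_subsetI)
    fix g assume g: "g \<in> files (cyclic_icp i L a) - knows (cyclic_icp i L a) k"
    have "label i L a g \<in> {1..?K}"
      unfolding label_def by (cases g) (simp only: prod.case wrap_in [OF K])
    moreover have "label i L a g \<notin> M"
      using g label_known [of _ i a _ L g k] unfolding M_def B_def by fastforce
    ultimately show "label i L a g \<in> {1..?K} - M" by blast
  qed
  then have "card (label i L a ` (files (cyclic_icp i L a) - knows (cyclic_icp i L a) k))
      \<le> card ({1..?K} - M)"
    by (intro card_mono) auto
  also have "\<dots> = ?K - (\<Sum>w = 1..<i. L - 1 - a w)"
    using M cardM finite_subset [OF M] by (simp add: card_Diff_subset)
  finally show ?thesis .
qed

theorem theorem1:
  fixes i L K :: nat and a :: "nat \<Rightarrow> nat"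
  assumes "i \<ge> 1" and "L \<ge> 1"
    and "\<forall>j\<in>{1..i}. a j \<le> a i"
    and "K = 1 + (i - 1) * L + (\<Sum>j = 1..i. a j)"
  shows "optimal_rate (cyclic_icp i L a) \<le>
    min (2 * (real K - (real i - 1) * real L) + real i - 2 - real (a i)) (real K)"
proof -
  let ?D = "\<Sum>w = 1..<i. L - 1 - a w" and ?A = "\<Sum>w = 1..<i. a w"
  have K: "num_users i L a = K" by (simp add: num_users_def assms(4))
  have rate: "optimal_rate (cyclic_icp i L a) \<le> real (K - ?D)"
    unfolding K [symmetric]
    by (rule optimal_rate_le_labels [OF valid_cyclic_icp card_missing_labels [OF assms(1)]])
      (rule same_label_known [OF assms(2)])
  have "{1..i} = insert i {1..<i}" using assms(1) by auto
  then have "K = 1 + (i - 1) * L + ?A + a i" by (simp add: assms(4))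
  then have K_real: "real K = 1 + (real i - 1) * real L + real ?A + real (a i)"
    using assms(1) by (simp add: of_nat_diff)
  have D_le: "?D \<le> K"
  proof -
    have "?D \<le> (\<Sum>w = 1..<i. L)" by (intro sum_mono) simp
    then show ?thesis by (simp add: assms(4))
  qed
  \<comment> \<open>Truncation only increases \<open>?D\<close>, so dropping it gives the first term
    of the minimum once \<open>?A\<close> is expressed through K. The second term follows from
    \<open>?D\<close> being non-negative.\<close>
  have "(real i - 1) * (real L - 1) - real ?A = (\<Sum>w = 1..<i. real L - 1 - real (a w))"
    using assms(1) by (simp add: sum_subtractf of_nat_diff right_diff_distrib)
  also have "\<dots> \<le> (\<Sum>w = 1..<i. real (L - 1 - a w))"
    by (intro sum_mono) linarith
  finally have "(real i - 1) * (real L - 1) - real ?A \<le> real ?D" by simp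
  then have "real (K - ?D) \<le> 2 * (real K - (real i - 1) * real L) + real i - 2 - real (a i)"
    using D_le K_real by (simp add: of_nat_diff algebra_simps)
  with rate show ?thesis by simp
qed

end
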